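(* Let $(N,N^\sharp)$ be a guarded Petri net (with $N^\sharp\colon\mathfrak F(N)\to\mathbf{Set}_*$) or a guarded Petri net with side effects (with $N^\sharp\colon\mathfrak F(N)\to\mathbf{Span}$), and let $(X,x)$ and $(Y,y)$ be markings of $(N,N^\sharp)$. Then $(Y,y)$ is reachable from $(X,x)$ in $(N,N^\sharp)$ if and only if $(Y,y)$ is reachable from $(X,x)$ in the (ordinary) Petri net $\mathfrak U\left(\int N^\sharp\right)$.
   Context: Composition is written in diagrammatic order: $f;g$ means first $f$, then $g$. A Petri net $N$ consists of a set of places, a set of transitions, and for each transition a finite multiset of input places and a finite multiset of output places. $\mathfrak F(N)$ denotes the free symmetric strict monoidal category (FSSMC) associated to $N$: its objects are finite words in the places (tensor is concatenation, unit $I$ is the empty word), and its morphisms are freely generated under composition, tensor, identities and symmetries, modulo only the axioms of symmetric strict monoidal categories, by one generating morphism per transition, whose source and target are words listing (in some fixed order) its input and output multisets. For an FSSMC $\mathcal C$, $\mathfrak U(\mathcal C)$ is the Petri net whose places are the generating objects of $\mathcal C$ and whose transitions are the generating morphisms, with inputs and outputs the multisets underlying their sources and targets. $\mathbf{Set}_*$ is the category of sets and partial functions; $\mathbf{Span}$ is the 1-category of sets and spans, isomorphic spans being identified. Both are symmetric monoidal with tensor the cartesian product of sets and unit $\{*\}$ (strictified versions are used). A morphism $f\colon A\to B$ of $\mathbf{Span}$ is written $A\xleftarrow{f_1}S_f\xrightarrow{f_2}B$; for $s\in S_f$ write $f(s)=(a,b)$ when $f_1(s)=a$, $f_2(s)=b$.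 Apexes of composites are pullbacks (pairs $(s,t)$ with $f_2(s)=g_1(t)$), apexes of tensors are products. A guarded net (resp. guarded net with side effects) is a pair $(N,N^\sharp)$ with $N$ a Petri net and $N^\sharp$ a strict symmetric monoidal functor from $\mathfrak F(N)$ to $\mathbf{Set}_*$ (resp. $\mathbf{Span}$). A marking of $(N,N^\sharp)$ is a pair $(X,x)$ with $X$ an object of $\mathfrak F(N)$ and $x\in N^\sharp X$. A marking $(Y,y)$ is reachable from $(X,x)$ in $(N,N^\sharp)$ if there is a morphism $f\colon X\to Y$ in $\mathfrak F(N)$ with $N^\sharp f(x)=y$; in the $\mathbf{Span}$ case this means that there is $s\in S_{N^\sharp f}$ with $N^\sharp f(s)=(x,y)$. The internalization $\int N^\sharp$ is the category whose objects are the pairs $(X,x)$ with $X\in\mathfrak F(N)$, $x\in N^\sharp X$, and whose morphisms $(X,x)\to(Y,y)$ are, in the $\mathbf{Set}_*$ case, morphisms $f\colon X\to Y$ of $\mathfrak F(N)$ with $N^\sharp f(x)=y$, and in the $\mathbf{Span}$ case, pairs $(f,s)$ with $f\colon X\to Y$ in $\mathfrak F(N)$, $s\in S_{N^\sharp f}$ and $N^\sharp f(s)=(x,y)$ (composition $(f,s);(g,t)=(f;g,(s,t))$). It is a symmetric strict monoidal category with $(X,x)\otimes(Y,y)=(X\otimes Y,(x,y))$, and it is regarded as an FSSMC with generating objects the pairs $(p,x)$, $p$ a place of $N$ and $x\in N^\sharp p$, and generating morphisms the morphisms $f\colon(X,x)\to(Y,y)$ (resp. $(f,s)$) with $f$ a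 generating morphism of $\mathfrak F(N)$. Thus an object $(X,x)=(p_1\otimes\dots\otimes p_n,(x_1,\dots,x_n))$ determines the marking of the net $\mathfrak U(\int N^\sharp)$ given by the multiset of places $(p_1,x_1),\dots,(p_n,x_n)$. Reachability in this ordinary Petri net is the usual one: a marking is reachable from another if it is obtained from it by a finite (possibly empty) sequence of transition firings. *)

theory Defs
  imports "HOL-Library.Multiset"
begin

section \<open>Strict symmetric monoidal categories and functors\<close>

text \<open>Composition \<open>Seq C f g\<close> is diagrammatic: first \<open>f\<close>, then \<open>g\<close>. The operations are only
  meaningful on objects and (composable) morphisms of the category.\<close>

record ('o, 'm) ssmc =
  Obj :: "'o set"
  Mor :: "'m set"
  Dom :: "'m \<Rightarrow> 'o"
  Cod :: "'m \<Rightarrow> 'o"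
  Ide :: "'o \<Rightarrow> 'm"
  Seq :: "'m \<Rightarrow> 'm \<Rightarrow> 'm"
  UnitO :: "'o"
  TensO :: "'o \<Rightarrow> 'o \<Rightarrow> 'o"
  TensM :: "'m \<Rightarrow> 'm \<Rightarrow> 'm"
  Swap :: "'o \<Rightarrow> 'o \<Rightarrow> 'm"

definition hom :: "('o, 'm) ssmc \<Rightarrow> 'o \<Rightarrow> 'o \<Rightarrow> 'm set" where
  "hom C X Y = {f \<in> Mor C. Dom C f = X \<and> Cod C f = Y}"

record ('o, 'm, 'p, 'n) ssm_functor =
  FO :: "'o \<Rightarrow> 'p"
  FM :: "'m \<Rightarrow> 'n"

definition strict_symmetric_monoidal_functor ::
  "('o, 'm) ssmc \<Rightarrow> ('p, 'n) ssmc \<Rightarrow> ('o, 'm, 'p, 'n) ssm_functor \<Rightarrow> bool" where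
  "strict_symmetric_monoidal_functor C D F \<longleftrightarrow>
     (\<forall>X \<in> Obj C. FO F X \<in> Obj D) \<and>
     (\<forall>f \<in> Mor C. FM F f \<in> hom D (FO F (Dom C f)) (FO F (Cod C f))) \<and>
     (\<forall>X \<in> Obj C. FM F (Ide C X) = Ide D (FO F X)) \<and>
     (\<forall>f \<in> Mor C. \<forall>g \<in> Mor C. Cod C f = Dom C g \<longrightarrow>
        FM F (Seq C f g) = Seq D (FM F f) (FM F g)) \<and>
     FO F (UnitO C) = UnitO D \<and>
     (\<forall>X \<in> Obj C. \<forall>Y \<in> Obj C. FO F (TensO C X Y) = TensO D (FO F X) (FO F Y)) \<and>
     (\<forall>f \<in> Mor C. \<forall>g \<in> Mor C. FM F (TensM C f g) = TensM D (FM F f) (FM F g)) \<and>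
     (\<forall>X \<in> Obj C. \<forall>Y \<in> Obj C. FM F (Swap C X Y) = Swap D (FO F X) (FO F Y))"


section \<open>Free symmetric strict monoidal categories\<close>

text \<open>An FSSMC is given by its generating objects and its generating morphisms, the latter with
  words of generating objects as source and target.\<close>

record ('o, 'm) fssmc =
  gen_obj :: "'o set"
  gen_mor :: "'m set"
  src :: "'m \<Rightarrow> 'o list"
  tgt :: "'m \<Rightarrow> 'o list"

datatype ('o, 'm) tm =
    TId "'o list"
  | TGen 'm
  | TSwap "'o list" "'o list"
  | TSeq "('o, 'm) tm" "('o, 'm) tm"
  | TTens "('o, 'm) tm" "('o, 'm) tm"

primrec tdom :: "('o, 'm) fssmc \<Rightarrow> ('o, 'm) tm \<Rightarrow> 'o list" where
  "tdom \<Sigma> (TId X) = X"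
| "tdom \<Sigma> (TGen t) = src \<Sigma> t"
| "tdom \<Sigma> (TSwap X Y) = X @ Y"
| "tdom \<Sigma> (TSeq f g) = tdom \<Sigma> f"
| "tdom \<Sigma> (TTens f g) = tdom \<Sigma> f @ tdom \<Sigma> g"

primrec tcod :: "('o, 'm) fssmc \<Rightarrow> ('o, 'm) tm \<Rightarrow> 'o list" where
  "tcod \<Sigma> (TId X) = X"
| "tcod \<Sigma> (TGen t) = tgt \<Sigma> t"
| "tcod \<Sigma> (TSwap X Y) = Y @ X"
| "tcod \<Sigma> (TSeq f g) = tcod \<Sigma> g"
| "tcod \<Sigma> (TTens f g) = tcod \<Sigma> f @ tcod \<Sigma> g"

primrec wf_tm :: "('o, 'm) fssmc \<Rightarrow> ('o, 'm) tm \<Rightarrow> bool" where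
  "wf_tm \<Sigma> (TId X) \<longleftrightarrow> X \<in> lists (gen_obj \<Sigma>)"
| "wf_tm \<Sigma> (TGen t) \<longleftrightarrow> t \<in> gen_mor \<Sigma>"
| "wf_tm \<Sigma> (TSwap X Y) \<longleftrightarrow> X \<in> lists (gen_obj \<Sigma>) \<and> Y \<in> lists (gen_obj \<Sigma>)"
| "wf_tm \<Sigma> (TSeq f g) \<longleftrightarrow> wf_tm \<Sigma> f \<and> wf_tm \<Sigma> g \<and> tcod \<Sigma> f = tdom \<Sigma> g"
| "wf_tm \<Sigma> (TTens f g) \<longleftrightarrow> wf_tm \<Sigma> f \<and> wf_tm \<Sigma> g"

text \<open>The congruence generated by the axioms of symmetric strict monoidal categories. It relates
  well-formed terms only, and preserves domain and codomain.\<close>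

inductive tm_eq :: "('o, 'm) fssmc \<Rightarrow> ('o, 'm) tm \<Rightarrow> ('o, 'm) tm \<Rightarrow> bool"
  for \<Sigma> :: "('o, 'm) fssmc" where
  refl: "wf_tm \<Sigma> f \<Longrightarrow> tm_eq \<Sigma> f f"
| sym: "tm_eq \<Sigma> f g \<Longrightarrow> tm_eq \<Sigma> g f"
| trans: "tm_eq \<Sigma> f g \<Longrightarrow> tm_eq \<Sigma> g h \<Longrightarrow> tm_eq \<Sigma> f h"
| seq_cong: "tm_eq \<Sigma> f f' \<Longrightarrow> tm_eq \<Sigma> g g' \<Longrightarrow> wf_tm \<Sigma> (TSeq f g) \<Longrightarrow>
    tm_eq \<Sigma> (TSeq f g) (TSeq f' g')"
| tens_cong: "tm_eq \<Sigma> f f' \<Longrightarrow> tm_eq \<Sigma> g g' \<Longrightarrow> tm_eq \<Sigma> (TTens f g) (TTens f' g')"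
| seq_id_left: "wf_tm \<Sigma> f \<Longrightarrow> tm_eq \<Sigma> (TSeq (TId (tdom \<Sigma> f)) f) f"
| seq_id_right: "wf_tm \<Sigma> f \<Longrightarrow> tm_eq \<Sigma> (TSeq f (TId (tcod \<Sigma> f))) f"
| seq_assoc: "wf_tm \<Sigma> (TSeq f (TSeq g h)) \<Longrightarrow>
    tm_eq \<Sigma> (TSeq (TSeq f g) h) (TSeq f (TSeq g h))"
| tens_id: "X \<in> lists (gen_obj \<Sigma>) \<Longrightarrow> Y \<in> lists (gen_obj \<Sigma>) \<Longrightarrow>
    tm_eq \<Sigma> (TTens (TId X) (TId Y)) (TId (X @ Y))"
| interchange: "wf_tm \<Sigma> (TSeq f g) \<Longrightarrow> wf_tm \<Sigma> (TSeq h k) \<Longrightarrow>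
    tm_eq \<Sigma> (TTens (TSeq f g) (TSeq h k)) (TSeq (TTens f h) (TTens g k))"
| tens_unit_left: "wf_tm \<Sigma> f \<Longrightarrow> tm_eq \<Sigma> (TTens (TId []) f) f"
| tens_unit_right: "wf_tm \<Sigma> f \<Longrightarrow> tm_eq \<Sigma> (TTens f (TId [])) f"
| tens_assoc: "wf_tm \<Sigma> f \<Longrightarrow> wf_tm \<Sigma> g \<Longrightarrow> wf_tm \<Sigma> h \<Longrightarrow>
    tm_eq \<Sigma> (TTens (TTens f g) h) (TTens f (TTens g h))"
| swap_natural: "wf_tm \<Sigma> f \<Longrightarrow> wf_tm \<Sigma> g \<Longrightarrow>
    tm_eq \<Sigma> (TSeq (TTens f g) (TSwap (tcod \<Sigma> f) (tcod \<Sigma> g)))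
            (TSeq (TSwap (tdom \<Sigma> f) (tdom \<Sigma> g)) (TTens g f))"
| swap_swap: "X \<in> lists (gen_obj \<Sigma>) \<Longrightarrow> Y \<in> lists (gen_obj \<Sigma>) \<Longrightarrow>
    tm_eq \<Sigma> (TSeq (TSwap X Y) (TSwap Y X)) (TId (X @ Y))"
| hexagon: "X \<in> lists (gen_obj \<Sigma>) \<Longrightarrow> Y \<in> lists (gen_obj \<Sigma>) \<Longrightarrow> Z \<in> lists (gen_obj \<Sigma>) \<Longrightarrow>
    tm_eq \<Sigma> (TSwap X (Y @ Z)) (TSeq (TTens (TSwap X Y) (TId Z)) (TTens (TId Y) (TSwap X Z)))"

definition tm_class :: "('o, 'm) fssmc \<Rightarrow> ('o, 'm) tm \<Rightarrow> ('o, 'm) tm set" where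
  "tm_class \<Sigma> f = {g. tm_eq \<Sigma> f g}"

definition free_ssmc :: "('o, 'm) fssmc \<Rightarrow> ('o list, ('o, 'm) tm set) ssmc" where
  "free_ssmc \<Sigma> =
     \<lparr>Obj = lists (gen_obj \<Sigma>),
      Mor = tm_class \<Sigma> ` {f. wf_tm \<Sigma> f},
      Dom = (\<lambda>c. the_elem (tdom \<Sigma> ` c)),
      Cod = (\<lambda>c. the_elem (tcod \<Sigma> ` c)),
      Ide = (\<lambda>X. tm_class \<Sigma> (TId X)),
      Seq = (\<lambda>c d. \<Union>f \<in> c. \<Union>g \<in> d. tm_class \<Sigma> (TSeq f g)),
      UnitO = [],
      TensO = (@),
      TensM = (\<lambda>c d. \<Union>f \<in> c. \<Union>g \<in> d. tm_class \<Sigma> (TTens f g)),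
      Swap = (\<lambda>X Y. tm_class \<Sigma> (TSwap X Y))\<rparr>"


section \<open>Petri nets\<close>

record ('p, 't) petri_net =
  places :: "'p set"
  transitions :: "'t set"
  inputs :: "'t \<Rightarrow> 'p multiset"
  outputs :: "'t \<Rightarrow> 'p multiset"

definition petri_net :: "('p, 't) petri_net \<Rightarrow> bool" where
  "petri_net N \<longleftrightarrow>
     (\<forall>t \<in> transitions N. set_mset (inputs N t) \<subseteq> places N \<and> set_mset (outputs N t) \<subseteq> places N)"

text \<open>\<open>free_on N \<Sigma>\<close>: \<open>\<Sigma>\<close> presents the FSSMC of \<open>N\<close>, the order in which each transition lists its
  inputs and outputs being fixed by \<open>\<Sigma>\<close>.\<close>

definition free_on :: "('p, 't) petri_net \<Rightarrow> ('p, 't) fssmc \<Rightarrow> bool" where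
  "free_on N \<Sigma> \<longleftrightarrow> gen_obj \<Sigma> = places N \<and> gen_mor \<Sigma> = transitions N \<and>
     (\<forall>t \<in> transitions N. mset (src \<Sigma> t) = inputs N t \<and> mset (tgt \<Sigma> t) = outputs N t)"

definition underlying_net :: "('o, 'm) fssmc \<Rightarrow> ('o, 'm) petri_net" where
  "underlying_net \<Sigma> =
     \<lparr>places = gen_obj \<Sigma>, transitions = gen_mor \<Sigma>,
      inputs = (\<lambda>t. mset (src \<Sigma> t)), outputs = (\<lambda>t. mset (tgt \<Sigma> t))\<rparr>"

definition fires :: "('p, 't) petri_net \<Rightarrow> 'p multiset \<Rightarrow> 'p multiset \<Rightarrow> bool" where
  "fires N M M' \<longleftrightarrow>
     (\<exists>t \<in> transitions N. inputs N t \<subseteq># M \<and> M' = M - inputs N t + outputs N t)"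

definition net_reachable :: "('p, 't) petri_net \<Rightarrow> 'p multiset \<Rightarrow> 'p multiset \<Rightarrow> bool" where
  "net_reachable N = (fires N)\<^sup>*\<^sup>*"


section \<open>Sets and partial functions\<close>

text \<open>Strictification: objects are finite words of sets, the word \<open>As\<close> standing for the product
  \<open>listset As\<close> of its entries, and morphisms are those between the products. The tensor of objects
  is concatenation, and the pair of \<open>x \<in> listset As\<close> and \<open>y \<in> listset Bs\<close> is
  \<open>x @ y \<in> listset (As @ Bs)\<close>.\<close>

record 'v pfun =
  pf_dom :: "'v set list"
  pf_map :: "'v list \<Rightarrow> 'v list option"
  pf_cod :: "'v set list"

definition pset :: "('v set list, 'v pfun) ssmc" where
  "pset =
     \<lparr>Obj = UNIV,
      Mor = {f. dom (pf_map f) \<subseteq> listset (pf_dom f) \<and> ran (pf_map f) \<subseteq> listset (pf_cod f)},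
      Dom = pf_dom,
      Cod = pf_cod,
      Ide = (\<lambda>As. \<lparr>pf_dom = As, pf_map = (\<lambda>x. if x \<in> listset As then Some x else None),
                  pf_cod = As\<rparr>),
      Seq = (\<lambda>f g. \<lparr>pf_dom = pf_dom f, pf_map = pf_map g \<circ>\<^sub>m pf_map f, pf_cod = pf_cod g\<rparr>),
      UnitO = [],
      TensO = (@),
      TensM = (\<lambda>f g. \<lparr>pf_dom = pf_dom f @ pf_dom g,
                     pf_map = (\<lambda>z. case (pf_map f (take (length (pf_dom f)) z),
                                         pf_map g (drop (length (pf_dom f)) z)) of
                                 (Some x, Some y) \<Rightarrow> Some (x @ y) | _ \<Rightarrow> None),
                     pf_cod = pf_cod f @ pf_cod g\<rparr>),
      Swap = (\<lambda>As Bs. \<lparr>pf_dom = As @ Bs,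
                      pf_map = (\<lambda>z. if z \<in> listset (As @ Bs)
                                    then Some (drop (length As) z @ take (length As) z) else None),
                      pf_cod = Bs @ As\<rparr>)\<rparr>"


section \<open>Sets and spans\<close>

text \<open>Apexes must be closed under pullbacks and products, so all sets here are subsets of a type
  that is closed under tuples.\<close>

datatype 'a univ = Atom 'a | Tuple (entries: "'a univ list")

record 'a span =
  sp_dom :: "'a univ set list"
  apex :: "'a univ set"
  leg1 :: "'a univ \<Rightarrow> 'a univ list"
  leg2 :: "'a univ \<Rightarrow> 'a univ list"
  sp_cod :: "'a univ set list"

definition span :: "'a span \<Rightarrow> bool" where
  "span R \<longleftrightarrow> leg1 R ` apex R \<subseteq> listset (sp_dom R) \<and> leg2 R ` apex R \<subseteq> listset (sp_cod R)"

definition span_iso :: "'a span \<Rightarrow> 'a span \<Rightarrow> bool" where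
  "span_iso R Q \<longleftrightarrow> sp_dom R = sp_dom Q \<and> sp_cod R = sp_cod Q \<and>
     (\<exists>\<phi>. bij_betw \<phi> (apex R) (apex Q) \<and>
          (\<forall>s \<in> apex R. leg1 Q (\<phi> s) = leg1 R s \<and> leg2 Q (\<phi> s) = leg2 R s))"

definition span_class :: "'a span \<Rightarrow> 'a span set" where
  "span_class R = {Q. span_iso R Q}"

definition span_id :: "'a univ set list \<Rightarrow> 'a span" where
  "span_id As =
     \<lparr>sp_dom = As, apex = Tuple ` listset As, leg1 = entries, leg2 = entries, sp_cod = As\<rparr>"

definition span_seq :: "'a span \<Rightarrow> 'a span \<Rightarrow> 'a span" where
  "span_seq R Q =
     \<lparr>sp_dom = sp_dom R,
      apex = {Tuple [s, t] | s t. s \<in> apex R \<and> t \<in> apex Q \<and> leg2 R s = leg1 Q t},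
      leg1 = (\<lambda>u. leg1 R (entries u ! 0)),
      leg2 = (\<lambda>u. leg2 Q (entries u ! 1)),
      sp_cod = sp_cod Q\<rparr>"

definition span_tens :: "'a span \<Rightarrow> 'a span \<Rightarrow> 'a span" where
  "span_tens R Q =
     \<lparr>sp_dom = sp_dom R @ sp_dom Q,
      apex = {Tuple [s, t] | s t. s \<in> apex R \<and> t \<in> apex Q},
      leg1 = (\<lambda>u. leg1 R (entries u ! 0) @ leg1 Q (entries u ! 1)),
      leg2 = (\<lambda>u. leg2 R (entries u ! 0) @ leg2 Q (entries u ! 1)),
      sp_cod = sp_cod R @ sp_cod Q\<rparr>"

definition span_swap :: "'a univ set list \<Rightarrow> 'a univ set list \<Rightarrow> 'a span" where
  "span_swap As Bs =
     \<lparr>sp_dom = As @ Bs,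
      apex = Tuple ` listset (As @ Bs),
      leg1 = entries,
      leg2 = (\<lambda>u. drop (length As) (entries u) @ take (length As) (entries u)),
      sp_cod = Bs @ As\<rparr>"

definition span_cat :: "('a univ set list, 'a span set) ssmc" where
  "span_cat =
     \<lparr>Obj = UNIV,
      Mor = span_class ` {R. span R},
      Dom = (\<lambda>c. the_elem (sp_dom ` c)),
      Cod = (\<lambda>c. the_elem (sp_cod ` c)),
      Ide = (\<lambda>As. span_class (span_id As)),
      Seq = (\<lambda>c d. \<Union>R \<in> c. \<Union>Q \<in> d. span_class (span_seq R Q)),
      UnitO = [],
      TensO = (@),
      TensM = (\<lambda>c d. \<Union>R \<in> c. \<Union>Q \<in> d. span_class (span_tens R Q)),
      Swap = (\<lambda>As Bs. span_class (span_swap As Bs))\<rparr>"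

text \<open>Morphisms are isomorphism classes, so speaking of the apex of a morphism requires a
  representative. Another choice of representatives leaves reachability unchanged and replaces
  the net of the internalization by an isomorphic one.\<close>

definition span_rep :: "'a span set \<Rightarrow> 'a span" where
  "span_rep c = (SOME R. R \<in> c)"


section \<open>Guarded nets and their markings\<close>

text \<open>For \<open>free_on N \<Sigma>\<close>, the category \<open>free_ssmc \<Sigma>\<close> is the FSSMC associated to \<open>N\<close>. The guard
  of a net may send a place to any word of sets.\<close>

definition guarded_net ::
  "('p, 't) petri_net \<Rightarrow> ('p, 't) fssmc \<Rightarrow>
   ('p list, ('p, 't) tm set, 'v set list, 'v pfun) ssm_functor \<Rightarrow> bool" where
  "guarded_net N \<Sigma> G \<longleftrightarrow>
     petri_net N \<and> free_on N \<Sigma> \<and> strict_symmetric_monoidal_functor (free_ssmc \<Sigma>) pset G"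

definition guarded_net_se ::
  "('p, 't) petri_net \<Rightarrow> ('p, 't) fssmc \<Rightarrow>
   ('p list, ('p, 't) tm set, 'a univ set list, 'a span set) ssm_functor \<Rightarrow> bool" where
  "guarded_net_se N \<Sigma> G \<longleftrightarrow>
     petri_net N \<and> free_on N \<Sigma> \<and> strict_symmetric_monoidal_functor (free_ssmc \<Sigma>) span_cat G"

definition markings ::
  "('p, 't) fssmc \<Rightarrow> ('p list, 'm, 'v set list, 'n) ssm_functor \<Rightarrow> ('p list \<times> 'v list) set" where
  "markings \<Sigma> G = {(X, x). X \<in> Obj (free_ssmc \<Sigma>) \<and> x \<in> listset (FO G X)}"

definition guarded_reachable ::
  "('p, 't) fssmc \<Rightarrow> ('p list, ('p, 't) tm set, 'v set list, 'v pfun) ssm_functor \<Rightarrow>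
   'p list \<times> 'v list \<Rightarrow> 'p list \<times> 'v list \<Rightarrow> bool" where
  "guarded_reachable \<Sigma> G = (\<lambda>(X, x) (Y, y).
     \<exists>f \<in> hom (free_ssmc \<Sigma>) X Y. pf_map (FM G f) x = Some y)"

definition guarded_reachable_se ::
  "('p, 't) fssmc \<Rightarrow> ('p list, ('p, 't) tm set, 'a univ set list, 'a span set) ssm_functor \<Rightarrow>
   'p list \<times> 'a univ list \<Rightarrow> 'p list \<times> 'a univ list \<Rightarrow> bool" where
  "guarded_reachable_se \<Sigma> G = (\<lambda>(X, x) (Y, y).
     \<exists>f \<in> hom (free_ssmc \<Sigma>) X Y. \<exists>s \<in> apex (span_rep (FM G f)).
       leg1 (span_rep (FM G f)) s = x \<and> leg2 (span_rep (FM G f)) s = y)"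


section \<open>Internalization\<close>

definition int_hom ::
  "('p, 't) fssmc \<Rightarrow> ('p list, ('p, 't) tm set, 'v set list, 'v pfun) ssm_functor \<Rightarrow>
   'p list \<times> 'v list \<Rightarrow> 'p list \<times> 'v list \<Rightarrow> ('p, 't) tm set set" where
  "int_hom \<Sigma> G = (\<lambda>(X, x) (Y, y).
     {f \<in> hom (free_ssmc \<Sigma>) X Y. pf_map (FM G f) x = Some y})"

definition int_hom_se ::
  "('p, 't) fssmc \<Rightarrow> ('p list, ('p, 't) tm set, 'a univ set list, 'a span set) ssm_functor \<Rightarrow>
   'p list \<times> 'a univ list \<Rightarrow> 'p list \<times> 'a univ list \<Rightarrow> (('p, 't) tm set \<times> 'a univ) set" where
  "int_hom_se \<Sigma> G = (\<lambda>(X, x) (Y, y).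
     {(f, s). f \<in> hom (free_ssmc \<Sigma>) X Y \<and> s \<in> apex (span_rep (FM G f)) \<and>
              leg1 (span_rep (FM G f)) s = x \<and> leg2 (span_rep (FM G f)) s = y})"

text \<open>The word of generating objects \<open>(p, x)\<close> whose tensor is a given object of the
  internalization: an element of \<open>listset (FO G (p # X))\<close> is cut after its first
  \<open>length (FO G [p])\<close> entries.\<close>

fun factors ::
  "('p list, 'm, 'v set list, 'n) ssm_functor \<Rightarrow> 'p list \<times> 'v list \<Rightarrow> ('p \<times> 'v list) list" where
  "factors G ([], x) = []"
| "factors G (p # X, x) =
     (p, take (length (FO G [p])) x) # factors G (X, drop (length (FO G [p])) x)"

text \<open>The internalization as an FSSMC, i.e. by its generating objects and by those of its morphisms
  that lie over generating morphisms of \<open>free_ssmc \<Sigma>\<close>; its underlying net depends on nothing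
  else. A morphism is recorded together with its source and target, since the same \<open>f\<close> may be a
  morphism between several pairs of objects.\<close>

definition int_gen_obj ::
  "('p, 't) fssmc \<Rightarrow> ('p list, 'm, 'v set list, 'n) ssm_functor \<Rightarrow> ('p \<times> 'v list) set" where
  "int_gen_obj \<Sigma> G = {(p, x). p \<in> gen_obj \<Sigma> \<and> x \<in> listset (FO G [p])}"

definition internalization ::
  "('p, 't) fssmc \<Rightarrow> ('p list, ('p, 't) tm set, 'v set list, 'v pfun) ssm_functor \<Rightarrow>
   ('p \<times> 'v list,
    ('p list \<times> 'v list) \<times> ('p, 't) tm set \<times> ('p list \<times> 'v list)) fssmc" where
  "internalization \<Sigma> G =
     \<lparr>gen_obj = int_gen_obj \<Sigma> G,
      gen_mor = {(a, f, b). a \<in> markings \<Sigma> G \<and> b \<in> markings \<Sigma> G \<and> f \<in> int_hom \<Sigma> G a b \<and>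
                            (\<exists>t \<in> gen_mor \<Sigma>. f = tm_class \<Sigma> (TGen t))},
      src = (\<lambda>(a, f, b). factors G a),
      tgt = (\<lambda>(a, f, b). factors G b)\<rparr>"

definition internalization_se ::
  "('p, 't) fssmc \<Rightarrow> ('p list, ('p, 't) tm set, 'a univ set list, 'a span set) ssm_functor \<Rightarrow>
   ('p \<times> 'a univ list,
    ('p list \<times> 'a univ list) \<times> (('p, 't) tm set \<times> 'a univ) \<times> ('p list \<times> 'a univ list)) fssmc"
  where
  "internalization_se \<Sigma> G =
     \<lparr>gen_obj = int_gen_obj \<Sigma> G,
      gen_mor = {(a, (f, s), b). a \<in> markings \<Sigma> G \<and> b \<in> markings \<Sigma> G \<and>
                                 (f, s) \<in> int_hom_se \<Sigma> G a b \<and>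
                                 (\<exists>t \<in> gen_mor \<Sigma>. f = tm_class \<Sigma> (TGen t))},
      src = (\<lambda>(a, fs, b). factors G a),
      tgt = (\<lambda>(a, fs, b). factors G b)\<rparr>"

definition net_marking ::
  "('p list, 'm, 'v set list, 'n) ssm_functor \<Rightarrow> 'p list \<times> 'v list \<Rightarrow> ('p \<times> 'v list) multiset"
  where
  "net_marking G a = mset (factors G a)"

end

theory Submission
  imports Defs
begin

text \<open>Reachability only asks whether some morphism relates \<open>x\<close> to \<open>y\<close>; it sees neither that a partial
  function is single-valued nor how many elements of an apex lie over \<open>(x, y)\<close>. So both kinds of
  guard may be replaced by what they induce in sets and relations: a partial function becomes its
  graph, a span becomes the set of pairs that are the image of some element of its apex. Both
  passages respect identities, composition, tensor and symmetries (\<open>pset_support\<close>,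
  \<open>span_support\<close>), so one argument serves for both, carried out for an arbitrary category of words of
  sets with such a passage to relations.

  Under a relational guard every term \<open>f\<close> of the free category relates values of its domain to
  values of its codomain. If \<open>f\<close> relates \<open>x\<close> to \<open>y\<close>, then induction on \<open>f\<close> turns \<open>f\<close> into a firing
  sequence (\<open>related_imp_fires\<close>): a generator is one firing, identities and symmetries do not
  change the multiset of coloured places, composition concatenates sequences, and a tensor runs
  one sequence beside the tokens of the other.

  Conversely, a marking of the net, listed in any order, is an object of the internalization.
  Two listings of the same multiset of coloured places are connected by a morphism built from symmetries
  (\<open>joined_perm\<close>), and a firing is the tensor of a generator with the identity on the tokens that
  are not consumed. Composing these along a firing sequence gives the morphism that is wanted
  (\<open>fires_imp_joined\<close>).\<close>

section \<open>Products of words of sets\<close>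

lemma length_listset: "x \<in> listset As \<Longrightarrow> length x = length As"
  by (induction As arbitrary: x) (auto simp: set_Cons_def)

lemma listset_append: "listset (As @ Bs) = {x @ y | x y. x \<in> listset As \<and> y \<in> listset Bs}"
proof (induction As)
  case (Cons A As)
  show ?case
    by (auto simp: Cons set_Cons_def) (metis append_Cons)+
qed auto

lemma take_drop_listset:
  assumes "z \<in> listset (As @ Bs)"
  shows "take (length As) z \<in> listset As" "drop (length As) z \<in> listset Bs"
proof -
  obtain x y where "z = x @ y" "x \<in> listset As" "y \<in> listset Bs"
    using assms by (auto simp: listset_append)
  then show "take (length As) z \<in> listset As" "drop (length As) z \<in> listset Bs"
    by (simp_all add: length_listset[symmetric])
qed

section \<open>The free symmetric strict monoidal category\<close>

text \<open>Operations on classes are unions over representatives; congruence makes all members of such a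
  union agree.\<close>

lemma UN_UN_const:
  assumes "a \<in> A" "b \<in> B" "\<And>x y. x \<in> A \<Longrightarrow> y \<in> B \<Longrightarrow> h x y = C"
  shows "(\<Union>x \<in> A. \<Union>y \<in> B. h x y) = C"
  using assms(1,2) assms(3)[OF assms(1,2)] by (simp add: assms(3) cong: SUP_cong_simp) blast

locale signature =
  fixes \<Sigma> :: "('p, 't) fssmc"
  assumes gen_typed: "t \<in> gen_mor \<Sigma> \<Longrightarrow>
    src \<Sigma> t \<in> lists (gen_obj \<Sigma>) \<and> tgt \<Sigma> t \<in> lists (gen_obj \<Sigma>)"
begin

abbreviation Ob where "Ob \<equiv> lists (gen_obj \<Sigma>)"

lemma tm_typed: "wf_tm \<Sigma> f \<Longrightarrow> tdom \<Sigma> f \<in> Ob \<and> tcod \<Sigma> f \<in> Ob"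
  by (induction f) (auto dest: gen_typed)

lemma tm_eq_typed:
  "tm_eq \<Sigma> f g \<Longrightarrow> wf_tm \<Sigma> f \<and> wf_tm \<Sigma> g \<and> tdom \<Sigma> f = tdom \<Sigma> g \<and> tcod \<Sigma> f = tcod \<Sigma> g"
  by (induction rule: tm_eq.induct) (use tm_typed in auto)

lemma tm_class_self: "wf_tm \<Sigma> f \<Longrightarrow> f \<in> tm_class \<Sigma> f"
  by (simp add: tm_class_def tm_eq.refl)

lemma tm_class_eq: "tm_eq \<Sigma> f g \<Longrightarrow> tm_class \<Sigma> g = tm_class \<Sigma> f"
  unfolding tm_class_def by (blast intro: tm_eq.sym tm_eq.trans)

lemma tm_class_memD:
  "g \<in> tm_class \<Sigma> f \<Longrightarrow> tm_eq \<Sigma> f g \<and> wf_tm \<Sigma> g \<and> tdom \<Sigma> g = tdom \<Sigma> f \<and> tcod \<Sigma> g = tcod \<Sigma> f"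
  using tm_eq_typed[of f g] by (simp add: tm_class_def)

lemma Dom_free: "wf_tm \<Sigma> f \<Longrightarrow> Dom (free_ssmc \<Sigma>) (tm_class \<Sigma> f) = tdom \<Sigma> f"
proof -
  assume "wf_tm \<Sigma> f"
  then have "tdom \<Sigma> ` tm_class \<Sigma> f = {tdom \<Sigma> f}"
    using tm_class_self tm_class_memD by (auto simp: image_iff)
  then show ?thesis by (simp add: free_ssmc_def)
qed

lemma Cod_free: "wf_tm \<Sigma> f \<Longrightarrow> Cod (free_ssmc \<Sigma>) (tm_class \<Sigma> f) = tcod \<Sigma> f"
proof -
  assume "wf_tm \<Sigma> f"
  then have "tcod \<Sigma> ` tm_class \<Sigma> f = {tcod \<Sigma> f}"
    using tm_class_self tm_class_memD by (auto simp: image_iff)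
  then show ?thesis by (simp add: free_ssmc_def)
qed

lemma Mor_free: "wf_tm \<Sigma> f \<Longrightarrow> tm_class \<Sigma> f \<in> Mor (free_ssmc \<Sigma>)"
  by (simp add: free_ssmc_def)

lemma hom_free: "hom (free_ssmc \<Sigma>) X Y =
    tm_class \<Sigma> ` {f. wf_tm \<Sigma> f \<and> tdom \<Sigma> f = X \<and> tcod \<Sigma> f = Y}"
proof -
  have "Mor (free_ssmc \<Sigma>) = tm_class \<Sigma> ` {f. wf_tm \<Sigma> f}" by (simp add: free_ssmc_def)
  then show ?thesis by (auto simp: hom_def Dom_free Cod_free)
qed

lemma Seq_free:
  assumes "wf_tm \<Sigma> (TSeq f g)"
  shows "Seq (free_ssmc \<Sigma>) (tm_class \<Sigma> f) (tm_class \<Sigma> g) = tm_class \<Sigma> (TSeq f g)"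
proof -
  have "tm_class \<Sigma> (TSeq f' g') = tm_class \<Sigma> (TSeq f g)"
    if "f' \<in> tm_class \<Sigma> f" "g' \<in> tm_class \<Sigma> g" for f' g'
    using that assms by (meson tm_class_memD tm_class_eq tm_eq.seq_cong)
  moreover have "f \<in> tm_class \<Sigma> f" "g \<in> tm_class \<Sigma> g"
    using assms tm_class_self by auto
  ultimately show ?thesis unfolding free_ssmc_def ssmc.simps by (intro UN_UN_const)
qed

lemma TensM_free:
  assumes "wf_tm \<Sigma> f" "wf_tm \<Sigma> g"
  shows "TensM (free_ssmc \<Sigma>) (tm_class \<Sigma> f) (tm_class \<Sigma> g) = tm_class \<Sigma> (TTens f g)"
proof -
  have "tm_class \<Sigma> (TTens f' g') = tm_class \<Sigma> (TTens f g)"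
    if "f' \<in> tm_class \<Sigma> f" "g' \<in> tm_class \<Sigma> g" for f' g'
    using that by (meson tm_class_memD tm_class_eq tm_eq.tens_cong)
  moreover have "f \<in> tm_class \<Sigma> f" "g \<in> tm_class \<Sigma> g"
    using assms tm_class_self by auto
  ultimately show ?thesis unfolding free_ssmc_def ssmc.simps by (intro UN_UN_const)
qed

end

section \<open>Guards seen as relations\<close>

text \<open>The map \<open>supp\<close> is a strict symmetric monoidal functor from \<open>D\<close> to sets and relations that
  sends a word of sets to its product, spelled out pointwise. Only this shadow of \<open>D\<close> enters the
  comparison of the two notions of reachability.\<close>

locale relational_support =
  fixes D :: "('v set list, 'n) ssmc" and supp :: "'n \<Rightarrow> 'v list \<Rightarrow> 'v list \<Rightarrow> bool"
  assumes UnitO: "UnitO D = []"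
    and TensO: "TensO D As Bs = As @ Bs"
    and supp_typed: "f \<in> Mor D \<Longrightarrow> supp f x y \<Longrightarrow> x \<in> listset (Dom D f) \<and> y \<in> listset (Cod D f)"
    and supp_Ide: "supp (Ide D As) x y \<longleftrightarrow> x \<in> listset As \<and> y = x"
    and supp_Seq: "f \<in> Mor D \<Longrightarrow> g \<in> Mor D \<Longrightarrow> Cod D f = Dom D g \<Longrightarrow>
      supp (Seq D f g) x z \<longleftrightarrow> (\<exists>y. supp f x y \<and> supp g y z)"
    and supp_TensM: "f \<in> Mor D \<Longrightarrow> g \<in> Mor D \<Longrightarrow>
      supp (TensM D f g) z w \<longleftrightarrow>
        (\<exists>x x' y y'. z = x @ x' \<and> w = y @ y' \<and> supp f x y \<and> supp g x' y')"
    and supp_Swap: "supp (Swap D As Bs) z w \<longleftrightarrow>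
      (\<exists>x y. x \<in> listset As \<and> y \<in> listset Bs \<and> z = x @ y \<and> w = y @ x)"

locale relational_guard = relational_support D supp + signature \<Sigma>
  for D :: "('v set list, 'n) ssmc" and supp :: "'n \<Rightarrow> 'v list \<Rightarrow> 'v list \<Rightarrow> bool"
    and \<Sigma> :: "('p, 't) fssmc" +
  fixes G :: "('p list, ('p, 't) tm set, 'v set list, 'n) ssm_functor"
  assumes functorial: "strict_symmetric_monoidal_functor (free_ssmc \<Sigma>) D G"
begin

text \<open>The relational guard pulled back to terms, where the axioms of \<open>supp\<close> become recursion
  equations on the constructors.\<close>

definition related :: "('p, 't) tm \<Rightarrow> 'v list \<Rightarrow> 'v list \<Rightarrow> bool" where
  "related f = supp (FM G (tm_class \<Sigma> f))"

lemma FO_Nil: "FO G [] = []"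
  using functorial by (simp add: strict_symmetric_monoidal_functor_def UnitO free_ssmc_def)

lemma FO_append: "X \<in> Ob \<Longrightarrow> Y \<in> Ob \<Longrightarrow> FO G (X @ Y) = FO G X @ FO G Y"
  using functorial by (simp add: strict_symmetric_monoidal_functor_def TensO free_ssmc_def)

lemma FM_typed:
  assumes "wf_tm \<Sigma> f"
  shows "FM G (tm_class \<Sigma> f) \<in> Mor D" "Dom D (FM G (tm_class \<Sigma> f)) = FO G (tdom \<Sigma> f)"
    "Cod D (FM G (tm_class \<Sigma> f)) = FO G (tcod \<Sigma> f)"
  using functorial assms Mor_free[OF assms]
  by (auto simp: strict_symmetric_monoidal_functor_def hom_def Dom_free Cod_free)

lemma related_typed:
  assumes "wf_tm \<Sigma> f" "related f x y"
  shows "x \<in> listset (FO G (tdom \<Sigma> f))" "y \<in> listset (FO G (tcod \<Sigma> f))"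
  using supp_typed[of "FM G (tm_class \<Sigma> f)" x y] FM_typed[OF assms(1)] assms(2)
  by (auto simp: related_def)

lemma related_TId: "X \<in> Ob \<Longrightarrow> related (TId X) x y \<longleftrightarrow> x \<in> listset (FO G X) \<and> y = x"
  using functorial
  by (simp add: related_def strict_symmetric_monoidal_functor_def free_ssmc_def supp_Ide)

lemma related_TSwap: "X \<in> Ob \<Longrightarrow> Y \<in> Ob \<Longrightarrow> related (TSwap X Y) z w \<longleftrightarrow>
    (\<exists>x y. x \<in> listset (FO G X) \<and> y \<in> listset (FO G Y) \<and> z = x @ y \<and> w = y @ x)"
  using functorial
  by (simp add: related_def strict_symmetric_monoidal_functor_def free_ssmc_def supp_Swap)

lemma related_TSeq:
  assumes "wf_tm \<Sigma> (TSeq f g)"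
  shows "related (TSeq f g) x z \<longleftrightarrow> (\<exists>y. related f x y \<and> related g y z)"
proof -
  have wf: "wf_tm \<Sigma> f" "wf_tm \<Sigma> g" "tcod \<Sigma> f = tdom \<Sigma> g" using assms by auto
  have "FM G (tm_class \<Sigma> (TSeq f g)) = Seq D (FM G (tm_class \<Sigma> f)) (FM G (tm_class \<Sigma> g))"
    using functorial Mor_free[OF wf(1)] Mor_free[OF wf(2)] wf
    by (simp add: strict_symmetric_monoidal_functor_def Seq_free[OF assms, symmetric]
        Dom_free Cod_free)
  then show ?thesis
    using wf by (simp add: related_def supp_Seq FM_typed)
qed

lemma related_TTens:
  assumes wf: "wf_tm \<Sigma> f" "wf_tm \<Sigma> g"
  shows "related (TTens f g) z w \<longleftrightarrow>
    (\<exists>x x' y y'. z = x @ x' \<and> w = y @ y' \<and> related f x y \<and> related g x' y')"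
proof -
  have "FM G (tm_class \<Sigma> (TTens f g)) = TensM D (FM G (tm_class \<Sigma> f)) (FM G (tm_class \<Sigma> g))"
    using functorial Mor_free[OF wf(1)] Mor_free[OF wf(2)]
    by (simp add: strict_symmetric_monoidal_functor_def TensM_free[OF wf, symmetric])
  then show ?thesis
    using wf by (simp add: related_def supp_TensM FM_typed)
qed

section \<open>Markings as words of coloured places\<close>

text \<open>A marking \<open>(X, x)\<close> of the guarded net and its list of factors determine each other: the
  length of \<open>FO G [p]\<close> tells where to cut \<open>x\<close>. Hence a list of pairs \<open>(p, v)\<close> can stand for a
  marking, and the tensor of markings becomes concatenation of lists.\<close>

abbreviation Places where "Places \<equiv> int_gen_obj \<Sigma> G"

abbreviation "obj ks \<equiv> map fst ks"
abbreviation "val ks \<equiv> concat (map snd ks)"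

lemma FO_Cons: "p \<in> gen_obj \<Sigma> \<Longrightarrow> X \<in> Ob \<Longrightarrow> FO G (p # X) = FO G [p] @ FO G X"
  using FO_append[of "[p]" X] by simp

lemma factors_val_obj:
  assumes "ks \<in> lists Places"
  shows "obj ks \<in> Ob" "val ks \<in> listset (FO G (obj ks))" "factors G (obj ks, val ks) = ks"
proof -
  have "obj ks \<in> Ob \<and> val ks \<in> listset (FO G (obj ks)) \<and> factors G (obj ks, val ks) = ks"
    using assms
  proof (induction ks)
    case Nil
    then show ?case by (simp add: FO_Nil)
  next
    case (Cons k ks)
    obtain p x where k: "k = (p, x)" by force
    with Cons have "p \<in> gen_obj \<Sigma>" "x \<in> listset (FO G [p])" by (auto simp: int_gen_obj_def)
    with Cons k FO_Cons[of p "obj ks"] show ?case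
      by (auto simp: listset_append length_listset)
  qed
  then show "obj ks \<in> Ob" "val ks \<in> listset (FO G (obj ks))" "factors G (obj ks, val ks) = ks"
    by auto
qed

lemma factors_marking:
  assumes "X \<in> Ob" "x \<in> listset (FO G X)"
  shows "factors G (X, x) \<in> lists Places" "obj (factors G (X, x)) = X" "val (factors G (X, x)) = x"
proof -
  have "factors G (X, x) \<in> lists Places \<and> obj (factors G (X, x)) = X \<and> val (factors G (X, x)) = x"
    using assms
  proof (induction X arbitrary: x)
    case Nil
    then show ?case by (simp add: FO_Nil)
  next
    case (Cons p X)
    then have x: "x \<in> listset (FO G [p] @ FO G X)" using FO_Cons[of p X] by simp
    with Cons take_drop_listset[OF x] show ?case
      by (auto simp: int_gen_obj_def)
  qed
  then show "factors G (X, x) \<in> lists Places" "obj (factors G (X, x)) = X"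
    "val (factors G (X, x)) = x"
    by auto
qed

lemma factors_append:
  assumes "X \<in> Ob" "x \<in> listset (FO G X)" "Y \<in> Ob" "y \<in> listset (FO G Y)"
  shows "factors G (X @ Y, x @ y) = factors G (X, x) @ factors G (Y, y)"
  using factors_val_obj(3)[of "factors G (X, x) @ factors G (Y, y)"]
    factors_marking[OF assms(1,2)] factors_marking[OF assms(3,4)]
  by simp

section \<open>Firings\<close>

text \<open>The firing relation of the net of the internalization, with transitions read off from the
  relational guard: \<open>K\<close> collects the tokens that are not consumed. This form refers neither to the
  names of transitions nor to elements of apexes, in which the two internalizations differ.\<close>

definition fire :: "('p \<times> 'v list) multiset \<Rightarrow> ('p \<times> 'v list) multiset \<Rightarrow> bool" where
  "fire M M' \<longleftrightarrow> (\<exists>t \<in> gen_mor \<Sigma>. \<exists>x y K. related (TGen t) x y \<and>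
     M = mset (factors G (src \<Sigma> t, x)) + K \<and> M' = mset (factors G (tgt \<Sigma> t, y)) + K)"

lemma fire_add:
  assumes "fire M M'"
  shows "fire (M + K) (M' + K)"
  using assms unfolding fire_def by (metis add.assoc)

lemma fires_add: "fire\<^sup>*\<^sup>* M M' \<Longrightarrow> fire\<^sup>*\<^sup>* (M + K) (M' + K)"
  by (induction rule: rtranclp_induct) (auto intro: fire_add rtranclp.rtrancl_into_rtrancl)

lemma fires_tens:
  assumes "fire\<^sup>*\<^sup>* M M'" "fire\<^sup>*\<^sup>* K K'"
  shows "fire\<^sup>*\<^sup>* (M + K) (M' + K')"
  using fires_add[OF assms(1), of K] fires_add[OF assms(2), of M']
  by (simp add: add.commute)

text \<open>Terms rather than their classes are the right objects for this induction: each
  constructor corresponds to an operation on firing sequences.\<close>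

lemma related_imp_fires:
  assumes "wf_tm \<Sigma> f" "related f x y"
  shows "fire\<^sup>*\<^sup>* (mset (factors G (tdom \<Sigma> f, x))) (mset (factors G (tcod \<Sigma> f, y)))"
  using assms
proof (induction f arbitrary: x y)
  case (TId X)
  then show ?case by (simp add: related_TId)
next
  case (TGen t)
  then have "fire (mset (factors G (src \<Sigma> t, x))) (mset (factors G (tgt \<Sigma> t, y)))"
    unfolding fire_def wf_tm.simps by (metis add.right_neutral)
  then show ?case by auto
next
  case (TSwap X Y)
  \<comment> \<open>Unfolding membership in \<open>Ob\<close> would block the side conditions of \<open>factors_append\<close>.\<close>
  then show ?case by (auto simp: related_TSwap factors_append add.commute del: in_listsD)
next
  case (TSeq f g)
  from TSeq.prems obtain z where "related f x z" "related g z y" by (auto simp: related_TSeq)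
  with TSeq show ?case by (fastforce intro: rtranclp_trans)
next
  case (TTens f g)
  then have wf: "wf_tm \<Sigma> f" "wf_tm \<Sigma> g" by auto
  from TTens.prems obtain x1 x2 y1 y2 where
    *: "x = x1 @ x2" "y = y1 @ y2" "related f x1 y1" "related g x2 y2"
    by (auto simp: related_TTens)
  with wf TTens.IH fires_tens show ?case
    by (simp add: factors_append tm_typed related_typed)
qed

section \<open>Realising firings by morphisms\<close>

text \<open>The words \<open>ks\<close> and \<open>ls\<close> of coloured places are objects of the internalization, and \<open>joined\<close>
  says that its hom-set between them is inhabited.\<close>

definition joined :: "('p \<times> 'v list) list \<Rightarrow> ('p \<times> 'v list) list \<Rightarrow> bool" where
  "joined ks ls \<longleftrightarrow>
     (\<exists>f. wf_tm \<Sigma> f \<and> tdom \<Sigma> f = obj ks \<and> tcod \<Sigma> f = obj ls \<and> related f (val ks) (val ls))"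

lemma joined_refl: "ks \<in> lists Places \<Longrightarrow> joined ks ks"
  unfolding joined_def
  by (rule exI[of _ "TId (obj ks)"]) (auto simp: related_TId factors_val_obj)

lemma joined_trans:
  assumes "joined ks ls" "joined ls ms"
  shows "joined ks ms"
proof -
  from assms obtain f g where
    "wf_tm \<Sigma> f" "tdom \<Sigma> f = obj ks" "tcod \<Sigma> f = obj ls" "related f (val ks) (val ls)"
    "wf_tm \<Sigma> g" "tdom \<Sigma> g = obj ls" "tcod \<Sigma> g = obj ms" "related g (val ls) (val ms)"
    unfolding joined_def by blast
  then show ?thesis
    unfolding joined_def by (intro exI[of _ "TSeq f g"]) (auto simp: related_TSeq)
qed

lemma joined_append:
  assumes "joined ks ls" "joined ks' ls'"
  shows "joined (ks @ ks') (ls @ ls')"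
proof -
  from assms obtain f g where
    "wf_tm \<Sigma> f" "tdom \<Sigma> f = obj ks" "tcod \<Sigma> f = obj ls" "related f (val ks) (val ls)"
    "wf_tm \<Sigma> g" "tdom \<Sigma> g = obj ks'" "tcod \<Sigma> g = obj ls'" "related g (val ks') (val ls')"
    unfolding joined_def by blast
  then show ?thesis
    unfolding joined_def by (intro exI[of _ "TTens f g"]) (auto simp: related_TTens)
qed

lemma joined_swap:
  assumes "ks \<in> lists Places" "ls \<in> lists Places"
  shows "joined (ks @ ls) (ls @ ks)"
  using factors_val_obj[OF assms(1)] factors_val_obj[OF assms(2)]
  unfolding joined_def
  by (intro exI[of _ "TSwap (obj ks) (obj ls)"]) (auto simp: related_TSwap)

text \<open>Symmetries of the free category realise every permutation of a word, the values being
  permuted along with the places: the head of \<open>ks\<close> is moved past the prefix \<open>ls1\<close> that precedes it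
  in \<open>ls\<close>.\<close>

lemma joined_perm:
  assumes "ks \<in> lists Places" "mset ks = mset ls"
  shows "joined ks ls"
  using assms
  \<comment> \<open>The explicit rule prevents a rule induction on the membership in \<open>lists Places\<close>.\<close>
proof (induction ks arbitrary: ls rule: list.induct)
  case Nil
  then show ?case using joined_refl[of "[]"] by simp
next
  case (Cons k ks)
  from Cons.prems(2) have "k \<in> set ls" by (metis list.set_intros(1) set_mset_mset)
  then obtain ls1 ls2 where ls: "ls = ls1 @ k # ls2" by (meson split_list)
  with Cons.prems have ms: "mset ks = mset (ls1 @ ls2)" by simp
  have Pl: "k \<in> Places" "ls1 \<in> lists Places" "ls2 \<in> lists Places"
    using Cons.prems ms mset_eq_setD[OF ms] by auto
  have "joined ([k] @ ks) ([k] @ ls1 @ ls2)"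
    using Cons.IH[OF _ ms] Cons.prems Pl by (intro joined_append joined_refl) auto
  moreover have "joined (([k] @ ls1) @ ls2) ((ls1 @ [k]) @ ls2)"
    using Pl by (intro joined_append joined_swap joined_refl) auto
  ultimately show ?case
    using joined_trans ls by fastforce
qed

text \<open>A firing connects only suitably ordered words, with the consumed tokens in front in the order
  in which the generator lists them. The order of the target is arbitrary, that of the source
  is chosen here; \<open>joined_perm\<close> makes up for the choice in the induction that follows.\<close>

lemma joined_fire:
  assumes "fire (mset ks) (mset ls)" "ls \<in> lists Places"
  obtains ks' where "mset ks' = mset ks" "ks' \<in> lists Places" "joined ks' ls"
proof -
  from assms(1) obtain t x y K where t: "t \<in> gen_mor \<Sigma>" "related (TGen t) x y"
    and ks: "mset ks = mset (factors G (src \<Sigma> t, x)) + K"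
    and ls: "mset ls = mset (factors G (tgt \<Sigma> t, y)) + K"
    unfolding fire_def by blast
  let ?s = "factors G (src \<Sigma> t, x)" and ?t = "factors G (tgt \<Sigma> t, y)"
  obtain rs where rs: "mset rs = K" using ex_mset by blast
  have "set rs \<subseteq> set ls" using ls rs by (metis mset_append mset_eq_setD set_append Un_upper2)
  then have rsP: "rs \<in> lists Places" using assms(2) by auto
  have xy: "x \<in> listset (FO G (src \<Sigma> t))" "y \<in> listset (FO G (tgt \<Sigma> t))"
    using related_typed[of "TGen t" x y] t by auto
  note s = factors_marking[OF conjunct1[OF gen_typed[OF t(1)]] xy(1)]
  note tt = factors_marking[OF conjunct2[OF gen_typed[OF t(1)]] xy(2)]
  have "joined ?s ?t"
    unfolding joined_def using t s tt by (intro exI[of _ "TGen t"]) simp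
  then have "joined (?s @ rs) (?t @ rs)"
    using rsP by (intro joined_append joined_refl)
  moreover have "joined (?t @ rs) ls"
    using tt(1) rsP ls rs by (intro joined_perm) auto
  ultimately have "joined (?s @ rs) ls" by (rule joined_trans)
  then show ?thesis
    using that[of "?s @ rs"] s(1) rsP ks rs by simp
qed

text \<open>The claim is for every listing \<open>ls\<close> of the reached multiset: the induction hypothesis is needed
  for the listing that \<open>joined_fire\<close> returns.\<close>

lemma fires_imp_joined:
  assumes "fire\<^sup>*\<^sup>* (mset ks) M" "ks \<in> lists Places" "mset ls = M" "ls \<in> lists Places"
  shows "joined ks ls"
  using assms
proof (induction arbitrary: ls rule: rtranclp_induct)
  case base
  then show ?case by (simp add: joined_perm)
next
  case (step M M')
  obtain ms where ms: "mset ms = M" using ex_mset by blast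
  from step.hyps(2) step.prems ms obtain ms' where
    "mset ms' = mset ms" "ms' \<in> lists Places" "joined ms' ls"
    by (metis joined_fire)
  with step.IH step.prems ms show ?case by (metis joined_trans)
qed

lemma related_iff_fires:
  assumes "(X, x) \<in> markings \<Sigma> G" "(Y, y) \<in> markings \<Sigma> G"
  shows "(\<exists>f \<in> hom (free_ssmc \<Sigma>) X Y. supp (FM G f) x y) \<longleftrightarrow>
    fire\<^sup>*\<^sup>* (net_marking G (X, x)) (net_marking G (Y, y))"
proof -
  have X: "X \<in> Ob" "x \<in> listset (FO G X)" and Y: "Y \<in> Ob" "y \<in> listset (FO G Y)"
    using assms by (auto simp: markings_def free_ssmc_def)
  have "(\<exists>f \<in> hom (free_ssmc \<Sigma>) X Y. supp (FM G f) x y) \<longleftrightarrow>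
      joined (factors G (X, x)) (factors G (Y, y))"
    by (auto simp: hom_free joined_def related_def factors_marking[OF X] factors_marking[OF Y])
  moreover have "joined (factors G (X, x)) (factors G (Y, y)) \<longleftrightarrow>
      fire\<^sup>*\<^sup>* (net_marking G (X, x)) (net_marking G (Y, y))"
    using fires_imp_joined related_imp_fires factors_marking[OF X] factors_marking[OF Y]
    unfolding joined_def net_marking_def by metis
  ultimately show ?thesis by simp
qed

text \<open>The class of \<open>TGen t\<close> lies in one hom-set only, so its transitions in the internalization may
  range over all pairs of markings and still consume and produce what \<open>fire\<close> prescribes.\<close>

lemma fire_iff_hom:
  "fire M M' \<longleftrightarrow> (\<exists>t \<in> gen_mor \<Sigma>. \<exists>X x Y y. (X, x) \<in> markings \<Sigma> G \<and> (Y, y) \<in> markings \<Sigma> G \<and>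
     tm_class \<Sigma> (TGen t) \<in> hom (free_ssmc \<Sigma>) X Y \<and> supp (FM G (tm_class \<Sigma> (TGen t))) x y \<and>
     mset (factors G (X, x)) \<subseteq># M \<and>
     M' = M - mset (factors G (X, x)) + mset (factors G (Y, y)))" (is "_ \<longleftrightarrow> ?R")
proof
  assume "fire M M'"
  then obtain t x y K where t: "t \<in> gen_mor \<Sigma>" "related (TGen t) x y"
    and M: "M = mset (factors G (src \<Sigma> t, x)) + K" "M' = mset (factors G (tgt \<Sigma> t, y)) + K"
    unfolding fire_def by blast
  show ?R
    using t M related_typed[of "TGen t" x y] gen_typed[OF t(1)]
    by (intro bexI[OF _ t(1)] exI[of _ "src \<Sigma> t"] exI[of _ "tgt \<Sigma> t"] exI[of _ x] exI[of _ y])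
      (auto simp: markings_def free_ssmc_def hom_def related_def Mor_free
         Dom_free[unfolded free_ssmc_def, simplified] Cod_free[unfolded free_ssmc_def, simplified])
next
  assume ?R
  then obtain t X x Y y where t: "t \<in> gen_mor \<Sigma>" "tm_class \<Sigma> (TGen t) \<in> hom (free_ssmc \<Sigma>) X Y"
      "supp (FM G (tm_class \<Sigma> (TGen t))) x y"
    and M: "mset (factors G (X, x)) \<subseteq># M"
      "M' = M - mset (factors G (X, x)) + mset (factors G (Y, y))"
    by blast
  have "X = src \<Sigma> t" "Y = tgt \<Sigma> t"
    using t(1,2) Dom_free[of "TGen t"] Cod_free[of "TGen t"] by (auto simp: hom_def)
  then show "fire M M'"
    unfolding fire_def related_def using t M
    by (metis add.commute subset_mset.add_diff_inverse)
qed

text \<open>Only the pairs of input and output multisets of a net matter for its firings. This absorbs the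
  difference between the two internalizations, one of which has a transition for each element of
  an apex.\<close>

lemma fires_eq_fire:
  fixes P :: "('p \<times> 'v list, 'u) petri_net"
  assumes "\<And>A B. (\<exists>u \<in> transitions P. A = inputs P u \<and> B = outputs P u) \<longleftrightarrow>
    (\<exists>t \<in> gen_mor \<Sigma>. \<exists>X x Y y. (X, x) \<in> markings \<Sigma> G \<and> (Y, y) \<in> markings \<Sigma> G \<and>
       tm_class \<Sigma> (TGen t) \<in> hom (free_ssmc \<Sigma>) X Y \<and> supp (FM G (tm_class \<Sigma> (TGen t))) x y \<and>
       A = mset (factors G (X, x)) \<and> B = mset (factors G (Y, y)))"
  shows "fires P = fire"
proof (intro ext)
  fix M M'
  have "fires P M M' \<longleftrightarrow> (\<exists>A B. (\<exists>u \<in> transitions P. A = inputs P u \<and> B = outputs P u) \<and>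
      A \<subseteq># M \<and> M' = M - A + B)"
    unfolding fires_def by blast
  also have "\<dots> \<longleftrightarrow> fire M M'"
    unfolding assms fire_iff_hom by blast
  finally show "fires P M M' = fire M M'" .
qed

end

lemma net_gen_typed:
  assumes "petri_net N" "free_on N \<Sigma>" "t \<in> gen_mor \<Sigma>"
  shows "src \<Sigma> t \<in> lists (gen_obj \<Sigma>) \<and> tgt \<Sigma> t \<in> lists (gen_obj \<Sigma>)"
  using assms unfolding petri_net_def free_on_def by (metis in_lists_conv_set set_mset_mset subsetD)

section \<open>Partial functions\<close>

lemma pset_support: "relational_support pset (\<lambda>f x y. pf_map f x = Some y)"
proof (unfold_locales, goal_cases)
  case (3 f x y)
  then show ?case by (auto simp: pset_def ran_def)
next
  case (5 f g x z)
  then show ?case by (simp add: pset_def map_comp_Some_iff)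
next
  case (6 f g z w)
  then have dom: "pf_map f x = Some y \<Longrightarrow> length x = length (pf_dom f)" for x y
    by (auto simp: pset_def intro!: length_listset)
  show ?case
  proof
    assume "pf_map (TensM pset f g) z = Some w"
    then show "\<exists>x x' y y'. z = x @ x' \<and> w = y @ y' \<and> pf_map f x = Some y \<and> pf_map g x' = Some y'"
      by (auto simp: pset_def split: option.splits) (metis append_take_drop_id)
  next
    assume "\<exists>x x' y y'. z = x @ x' \<and> w = y @ y' \<and> pf_map f x = Some y \<and> pf_map g x' = Some y'"
    then show "pf_map (TensM pset f g) z = Some w"
      using dom by (auto simp: pset_def)
  qed
next
  case (7 As Bs z w)
  then show ?case by (force simp: pset_def listset_append dest: length_listset)
qed (auto simp: pset_def)

lemma guarded_net_iff:
  assumes "guarded_net N \<Sigma> G" "(X, x) \<in> markings \<Sigma> G" "(Y, y) \<in> markings \<Sigma> G"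
  shows "guarded_reachable \<Sigma> G (X, x) (Y, y) \<longleftrightarrow>
    net_reachable (underlying_net (internalization \<Sigma> G))
      (net_marking G (X, x)) (net_marking G (Y, y))"
proof -
  interpret relational_guard pset "\<lambda>f x y. pf_map f x = Some y" \<Sigma> G
    using assms(1) pset_support net_gen_typed[of N \<Sigma>]
    by (auto simp: guarded_net_def relational_guard_def signature_def relational_guard_axioms_def)
  have "fires (underlying_net (internalization \<Sigma> G)) = fire"
    by (rule fires_eq_fire) (auto simp: underlying_net_def internalization_def int_hom_def; blast)
  then show ?thesis
    using related_iff_fires[OF assms(2,3)] by (simp add: guarded_reachable_def net_reachable_def)
qed

section \<open>Spans\<close>

definition span_rel :: "'a span \<Rightarrow> 'a univ list \<Rightarrow> 'a univ list \<Rightarrow> bool" where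
  "span_rel R x y \<longleftrightarrow> (\<exists>s \<in> apex R. leg1 R s = x \<and> leg2 R s = y)"

lemma span_rel_iso:
  assumes "span_iso R Q"
  shows "span_rel Q = span_rel R"
proof -
  obtain \<phi> where "\<phi> ` apex R = apex Q"
    "\<forall>s \<in> apex R. leg1 Q (\<phi> s) = leg1 R s \<and> leg2 Q (\<phi> s) = leg2 R s"
    using assms by (auto simp: span_iso_def bij_betw_def)
  then show ?thesis
    unfolding span_rel_def fun_eq_iff by (metis (no_types, lifting) imageE imageI)
qed

lemma span_class_self: "R \<in> span_class R"
  unfolding span_class_def span_iso_def by (auto intro!: exI[of _ id])

lemma span_rel_class: "Q \<in> span_class R \<Longrightarrow> span_rel Q = span_rel R"
  by (simp add: span_class_def span_rel_iso)

lemma span_rel_rep: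
  assumes "c \<noteq> {}" "\<And>R. R \<in> c \<Longrightarrow> span_rel R = r"
  shows "span_rel (span_rep c) = r"
  using assms by (auto simp: span_rep_def some_in_eq)

lemma span_rel_rep_class: "span_rel (span_rep (span_class R)) = span_rel R"
  using span_class_self span_rel_class by (intro span_rel_rep) auto

lemma span_rel_seq: "span_rel (span_seq R Q) x z \<longleftrightarrow> (\<exists>y. span_rel R x y \<and> span_rel Q y z)"
proof
  assume "\<exists>y. span_rel R x y \<and> span_rel Q y z"
  then obtain s t where "s \<in> apex R" "t \<in> apex Q" "leg2 R s = leg1 Q t" "leg1 R s = x" "leg2 Q t = z"
    by (auto simp: span_rel_def)
  then show "span_rel (span_seq R Q) x z"
    unfolding span_rel_def by (intro bexI[of _ "Tuple [s, t]"]) (auto simp: span_seq_def)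
qed (auto simp: span_rel_def span_seq_def; metis)

lemma span_rel_tens: "span_rel (span_tens R Q) z w \<longleftrightarrow>
    (\<exists>x x' y y'. z = x @ x' \<and> w = y @ y' \<and> span_rel R x y \<and> span_rel Q x' y')"
proof
  assume "\<exists>x x' y y'. z = x @ x' \<and> w = y @ y' \<and> span_rel R x y \<and> span_rel Q x' y'"
  then obtain s t where "s \<in> apex R" "t \<in> apex Q"
    "z = leg1 R s @ leg1 Q t" "w = leg2 R s @ leg2 Q t"
    by (auto simp: span_rel_def)
  then show "span_rel (span_tens R Q) z w"
    unfolding span_rel_def by (intro bexI[of _ "Tuple [s, t]"]) (auto simp: span_tens_def)
qed (auto simp: span_rel_def span_tens_def; metis)

lemma Dom_Cod_span:
  "Dom span_cat (span_class R) = sp_dom R" "Cod span_cat (span_class R) = sp_cod R"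
proof -
  have "sp_dom ` span_class R = {sp_dom R}" "sp_cod ` span_class R = {sp_cod R}"
    using span_class_self[of R] by (auto simp: span_class_def span_iso_def)
  then show "Dom span_cat (span_class R) = sp_dom R" "Cod span_cat (span_class R) = sp_cod R"
    by (simp_all add: span_cat_def)
qed

lemma Mor_span: "f \<in> Mor span_cat \<Longrightarrow> \<exists>R. f = span_class R \<and> span R"
  by (auto simp: span_cat_def)

text \<open>Composition and tensor of classes of spans are unions of classes. Their representative may come
  from any pair of spans in the two classes, but all choices induce the same relation.\<close>

lemma span_rel_rep_Union:
  assumes "\<And>R' Q'. R' \<in> span_class R \<Longrightarrow> Q' \<in> span_class Q \<Longrightarrow> span_rel (h R' Q') = r"
  shows "span_rel (span_rep (\<Union>R' \<in> span_class R. \<Union>Q' \<in> span_class Q. span_class (h R' Q'))) = r"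
proof (rule span_rel_rep)
  show "(\<Union>R' \<in> span_class R. \<Union>Q' \<in> span_class Q. span_class (h R' Q')) \<noteq> {}"
    using span_class_self[of R] span_class_self[of Q] span_class_self[of "h R Q"] by auto
next
  fix S
  assume "S \<in> (\<Union>R' \<in> span_class R. \<Union>Q' \<in> span_class Q. span_class (h R' Q'))"
  then obtain R' Q' where "R' \<in> span_class R" "Q' \<in> span_class Q" "S \<in> span_class (h R' Q')"
    by blast
  then show "span_rel S = r"
    using assms span_rel_class by metis
qed

lemma span_support: "relational_support span_cat (\<lambda>c. span_rel (span_rep c))"
proof (unfold_locales, goal_cases)
  case (3 f x y)
  then obtain R where R: "f = span_class R" "span R" using Mor_span by blast
  with 3 show ?case
    by (auto simp: span_rel_rep_class Dom_Cod_span span_rel_def span_def)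
next
  case (4 As x y)
  then show ?case
    by (auto simp: span_cat_def span_rel_rep_class) (auto simp: span_rel_def span_id_def)
next
  case (5 f g x z)
  then obtain R Q where R: "f = span_class R" "g = span_class Q" using Mor_span by blast
  have "span_rel (span_rep (Seq span_cat f g)) = span_rel (span_seq R Q)"
    unfolding R span_cat_def ssmc.simps
    by (rule span_rel_rep_Union) (simp add: fun_eq_iff span_rel_seq span_rel_class)
  then show ?case by (simp add: R span_rel_rep_class span_rel_seq)
next
  case (6 f g z w)
  then obtain R Q where R: "f = span_class R" "g = span_class Q" using Mor_span by blast
  have "span_rel (span_rep (TensM span_cat f g)) = span_rel (span_tens R Q)"
    unfolding R span_cat_def ssmc.simps
    by (rule span_rel_rep_Union) (simp add: fun_eq_iff span_rel_tens span_rel_class)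
  then show ?case by (simp add: R span_rel_rep_class span_rel_tens)
next
  case (7 As Bs z w)
  have "span_rel (span_rep (Swap span_cat As Bs)) = span_rel (span_swap As Bs)"
    by (simp add: span_cat_def span_rel_rep_class)
  then show ?case
    by (force simp: span_rel_def span_swap_def listset_append dest: length_listset)
qed (auto simp: span_cat_def)

lemma guarded_net_se_iff:
  assumes "guarded_net_se N \<Sigma> G" "(X, x) \<in> markings \<Sigma> G" "(Y, y) \<in> markings \<Sigma> G"
  shows "guarded_reachable_se \<Sigma> G (X, x) (Y, y) \<longleftrightarrow>
    net_reachable (underlying_net (internalization_se \<Sigma> G))
      (net_marking G (X, x)) (net_marking G (Y, y))"
proof -
  interpret relational_guard span_cat "\<lambda>c. span_rel (span_rep c)" \<Sigma> G
    using assms(1) span_support net_gen_typed[of N \<Sigma>]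
    by (auto simp: guarded_net_se_def relational_guard_def signature_def
        relational_guard_axioms_def)
  have "fires (underlying_net (internalization_se \<Sigma> G)) = fire"
    by (rule fires_eq_fire)
      (auto simp: underlying_net_def internalization_se_def int_hom_se_def span_rel_def; blast)
  then show ?thesis
    using related_iff_fires[OF assms(2,3)]
    by (simp add: guarded_reachable_se_def net_reachable_def span_rel_def)
qed

theorem theorem2:
  fixes N :: "('p, 't) petri_net" and \<Sigma> :: "('p, 't) fssmc"
  shows
    "(\<forall>(G :: ('p list, ('p, 't) tm set, 'v set list, 'v pfun) ssm_functor) X x Y y.
        guarded_net N \<Sigma> G \<longrightarrow> (X, x) \<in> markings \<Sigma> G \<longrightarrow> (Y, y) \<in> markings \<Sigma> G \<longrightarrow>
        (guarded_reachable \<Sigma> G (X, x) (Y, y) \<longleftrightarrow>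
         net_reachable (underlying_net (internalization \<Sigma> G))
           (net_marking G (X, x)) (net_marking G (Y, y)))) \<and>
     (\<forall>(G :: ('p list, ('p, 't) tm set, 'a univ set list, 'a span set) ssm_functor) X x Y y.
        guarded_net_se N \<Sigma> G \<longrightarrow> (X, x) \<in> markings \<Sigma> G \<longrightarrow> (Y, y) \<in> markings \<Sigma> G \<longrightarrow>
        (guarded_reachable_se \<Sigma> G (X, x) (Y, y) \<longleftrightarrow>
         net_reachable (underlying_net (internalization_se \<Sigma> G))
           (net_marking G (X, x)) (net_marking G (Y, y))))"
  using guarded_net_iff guarded_net_se_iff by blast

end
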